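(* Let $\mathbb{C}_1,\dots,\mathbb{C}_n$ and $\mathbb{D}$ be comonads on categories $\mathcal{C}_1,\dots,\mathcal{C}_n$ and $\mathcal{D}$, let $H\colon\prod_i\mathcal{C}_i\to\mathcal{D}$ be a functor, and let $\kappa$ be a Kleisli law of type $\mathbb{D}\circ H\Rightarrow H\circ\prod_i\mathbb{C}_i$. If the category $\mathrm{EM}(\mathbb{D})$ of $\mathbb{D}$-coalgebras has equalisers, then there exists a functor $\widehat H\colon\prod_i\mathrm{EM}(\mathbb{C}_i)\to\mathrm{EM}(\mathbb{D})$ such that $\widehat H\circ\prod_i F^{\mathbb{C}_i}\cong F^{\mathbb{D}}\circ H$ (naturally isomorphic functors $\prod_i\mathcal{C}_i\to\mathrm{EM}(\mathbb{D})$).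
   Context: A comonad $(\mathbb{C},\varepsilon,\delta)$ on $\mathcal{C}$: endofunctor with natural counit $\varepsilon\colon\mathbb{C}\Rightarrow\mathrm{Id}$ and comultiplication $\delta\colon\mathbb{C}\Rightarrow\mathbb{C}^2$ satisfying the comonoid laws. A $\mathbb{C}$-coalgebra is a pair $(A,\alpha)$ with $\alpha\colon A\to\mathbb{C}(A)$ such that $\varepsilon_A\circ\alpha=\mathrm{id}_A$ and $\delta_A\circ\alpha=\mathbb{C}(\alpha)\circ\alpha$; a coalgebra morphism $f\colon(A,\alpha)\to(B,\beta)$ is $f\colon A\to B$ with $\beta\circ f=\mathbb{C}(f)\circ\alpha$. These form the category $\mathrm{EM}(\mathbb{C})$. The cofree coalgebra functor $F^{\mathbb{C}}\colon\mathcal{C}\to\mathrm{EM}(\mathbb{C})$ sends $A$ to $(\mathbb{C}(A),\delta_A)$ and $f$ to $\mathbb{C}(f)$. A Kleisli law of type $\mathbb{D}\circ H\Rightarrow H\circ\prod_i\mathbb{C}_i$ is a natural transformation $\kappa$ with components $\kappa_{\vec A}\colon\mathbb{D}(H(A_1,\dots,A_n))\to H(\mathbb{C}_1A_1,\dots,\mathbb{C}_nA_n)$ such that $H(\varepsilon_{A_1},\dots,\varepsilon_{A_n})\circ\kappa_{\vec A}=\varepsilon_{H(\vec A)}$ and $H(\delta_{A_1},\dots,\delta_{A_n})\circ\kappa_{\vec A}=\kappa_{\mathbb{C}_1A_1,\dots,\mathbb{C}_nA_n}\circ\mathbb{D}(\kappa_{\vec A})\circ\delta_{H(\vec A)}$.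 *)

theory Defs
  imports "HOL-Library.FuncSet"
begin

text \<open>
  Categories are carried by a set of objects and a set of arrows inside ambient types; the
  operations matter on these carriers only.  A family of categories
  \<open>\<C>\<^sub>1, \<dots>, \<C>\<^sub>n\<close> is a function from indices to categories over common ambient types,
  the carriers of its members being otherwise unrelated.
\<close>

section \<open>Categories, functors, natural transformations\<close>

record ('o, 'a) cat =
  Obj :: "'o set"
  Arr :: "'a set"
  Dom :: "'a \<Rightarrow> 'o"
  Cod :: "'a \<Rightarrow> 'o"
  Idn :: "'o \<Rightarrow> 'a"
  Cmp :: "'a \<Rightarrow> 'a \<Rightarrow> 'a" (infixr "\<cdot>\<index>" 55)

definition Hom :: "('o, 'a) cat \<Rightarrow> 'o \<Rightarrow> 'o \<Rightarrow> 'a set" where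
  "Hom C A B = {f \<in> Arr C. Dom C f = A \<and> Cod C f = B}"

locale category =
  fixes C :: "('o, 'a) cat" (structure)
  assumes Dom_Obj: "f \<in> Arr C \<Longrightarrow> Dom C f \<in> Obj C"
    and Cod_Obj: "f \<in> Arr C \<Longrightarrow> Cod C f \<in> Obj C"
    and Idn_Hom: "A \<in> Obj C \<Longrightarrow> Idn C A \<in> Hom C A A"
    and Cmp_Hom: "\<lbrakk>f \<in> Hom C A B; g \<in> Hom C B E\<rbrakk> \<Longrightarrow> g \<cdot> f \<in> Hom C A E"
    and Idn_left: "f \<in> Hom C A B \<Longrightarrow> Idn C B \<cdot> f = f"
    and Idn_right: "f \<in> Hom C A B \<Longrightarrow> f \<cdot> Idn C A = f"
    and Cmp_assoc: "\<lbrakk>f \<in> Hom C A B; g \<in> Hom C B E; h \<in> Hom C E G\<rbrakk>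
      \<Longrightarrow> (h \<cdot> g) \<cdot> f = h \<cdot> (g \<cdot> f)"

definition iso_arr :: "('o, 'a) cat \<Rightarrow> 'a \<Rightarrow> bool" where
  "iso_arr C f \<longleftrightarrow> f \<in> Arr C \<and>
    (\<exists>g \<in> Hom C (Cod C f) (Dom C f).
      g \<cdot>\<^bsub>C\<^esub> f = Idn C (Dom C f) \<and> f \<cdot>\<^bsub>C\<^esub> g = Idn C (Cod C f))"

definition is_equaliser :: "('o, 'a) cat \<Rightarrow> 'a \<Rightarrow> 'a \<Rightarrow> 'a \<Rightarrow> bool" where
  "is_equaliser C f g e \<longleftrightarrow>
    e \<in> Arr C \<and> Cod C e = Dom C f \<and> f \<cdot>\<^bsub>C\<^esub> e = g \<cdot>\<^bsub>C\<^esub> e \<and>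
    (\<forall>h \<in> Arr C. Cod C h = Dom C f \<longrightarrow> f \<cdot>\<^bsub>C\<^esub> h = g \<cdot>\<^bsub>C\<^esub> h \<longrightarrow>
      (\<exists>!u. u \<in> Hom C (Dom C h) (Dom C e) \<and> e \<cdot>\<^bsub>C\<^esub> u = h))"

definition has_equalisers :: "('o, 'a) cat \<Rightarrow> bool" where
  "has_equalisers C \<longleftrightarrow>
    (\<forall>A \<in> Obj C. \<forall>B \<in> Obj C. \<forall>f \<in> Hom C A B. \<forall>g \<in> Hom C A B. \<exists>e. is_equaliser C f g e)"

record ('o, 'a, 'p, 'b) ftr =
  FObj :: "'o \<Rightarrow> 'p"
  FArr :: "'a \<Rightarrow> 'b"

locale is_functor =
  C: category C + D: category D
  for C :: "('o, 'a) cat" and D :: "('p, 'b) cat" +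
  fixes F :: "('o, 'a, 'p, 'b) ftr"
  assumes FObj_Obj: "A \<in> Obj C \<Longrightarrow> FObj F A \<in> Obj D"
    and FArr_Hom: "f \<in> Hom C A B \<Longrightarrow> FArr F f \<in> Hom D (FObj F A) (FObj F B)"
    and FArr_Idn: "A \<in> Obj C \<Longrightarrow> FArr F (Idn C A) = Idn D (FObj F A)"
    and FArr_Cmp: "\<lbrakk>f \<in> Hom C A B; g \<in> Hom C B E\<rbrakk>
      \<Longrightarrow> FArr F (g \<cdot>\<^bsub>C\<^esub> f) = FArr F g \<cdot>\<^bsub>D\<^esub> FArr F f"

definition id_ftr :: "('o, 'a, 'o, 'a) ftr" where
  "id_ftr = \<lparr>FObj = (\<lambda>A. A), FArr = (\<lambda>f. f)\<rparr>"

definition comp_ftr :: "('p, 'b, 'q, 'c) ftr \<Rightarrow> ('o, 'a, 'p, 'b) ftr \<Rightarrow> ('o, 'a, 'q, 'c) ftr"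
    (infixr "\<circ>\<^sub>F" 60) where
  "G \<circ>\<^sub>F F = \<lparr>FObj = (\<lambda>A. FObj G (FObj F A)), FArr = (\<lambda>f. FArr G (FArr F f))\<rparr>"

locale nat_trans =
  F: is_functor C D F + G: is_functor C D G
  for C :: "('o, 'a) cat" and D :: "('p, 'b) cat"
    and F :: "('o, 'a, 'p, 'b) ftr" and G :: "('o, 'a, 'p, 'b) ftr" +
  fixes \<eta> :: "'o \<Rightarrow> 'b"
  assumes component: "A \<in> Obj C \<Longrightarrow> \<eta> A \<in> Hom D (FObj F A) (FObj G A)"
    and naturality: "f \<in> Hom C A B
      \<Longrightarrow> \<eta> B \<cdot>\<^bsub>D\<^esub> FArr F f = FArr G f \<cdot>\<^bsub>D\<^esub> \<eta> A"

definition nat_isomorphic ::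
    "('o, 'a) cat \<Rightarrow> ('p, 'b) cat \<Rightarrow> ('o, 'a, 'p, 'b) ftr \<Rightarrow> ('o, 'a, 'p, 'b) ftr \<Rightarrow> bool" where
  "nat_isomorphic C D F G \<longleftrightarrow>
    (\<exists>\<eta>. nat_trans C D F G \<eta> \<and> (\<forall>A \<in> Obj C. iso_arr D (\<eta> A)))"

section \<open>Products of categories\<close>

text \<open>
  Tuples indexed by \<open>I\<close> are extensional functions: outside \<open>I\<close> they are \<open>undefined\<close>, so that
  equality of tuples is componentwise equality on \<open>I\<close>.
\<close>

definition prod_cat :: "'i set \<Rightarrow> ('i \<Rightarrow> ('o, 'a) cat) \<Rightarrow> ('i \<Rightarrow> 'o, 'i \<Rightarrow> 'a) cat" where
  "prod_cat I \<C> =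
    \<lparr>Obj = (\<Pi>\<^sub>E i\<in>I. Obj (\<C> i)),
     Arr = (\<Pi>\<^sub>E i\<in>I. Arr (\<C> i)),
     Dom = (\<lambda>f. \<lambda>i\<in>I. Dom (\<C> i) (f i)),
     Cod = (\<lambda>f. \<lambda>i\<in>I. Cod (\<C> i) (f i)),
     Idn = (\<lambda>A. \<lambda>i\<in>I. Idn (\<C> i) (A i)),
     Cmp = (\<lambda>g f. \<lambda>i\<in>I. g i \<cdot>\<^bsub>\<C> i\<^esub> f i)\<rparr>"

definition prod_ftr ::
    "'i set \<Rightarrow> ('i \<Rightarrow> ('o, 'a, 'p, 'b) ftr) \<Rightarrow> ('i \<Rightarrow> 'o, 'i \<Rightarrow> 'a, 'i \<Rightarrow> 'p, 'i \<Rightarrow> 'b) ftr" where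
  "prod_ftr I F =
    \<lparr>FObj = (\<lambda>A. \<lambda>i\<in>I. FObj (F i) (A i)),
     FArr = (\<lambda>f. \<lambda>i\<in>I. FArr (F i) (f i))\<rparr>"

section \<open>Comonads and coalgebras\<close>

record ('o, 'a) comonad_data =
  Ftr :: "('o, 'a, 'o, 'a) ftr"
  counit :: "'o \<Rightarrow> 'a"
  comult :: "'o \<Rightarrow> 'a"

locale comonad =
  category C + is_functor C C "Ftr W"
    + counit: nat_trans C C "Ftr W" id_ftr "counit W"
    + comult: nat_trans C C "Ftr W" "Ftr W \<circ>\<^sub>F Ftr W" "comult W"
  for C :: "('o, 'a) cat" and W :: "('o, 'a) comonad_data" +
  assumes counit_left: "A \<in> Obj C
      \<Longrightarrow> counit W (FObj (Ftr W) A) \<cdot>\<^bsub>C\<^esub> comult W A = Idn C (FObj (Ftr W) A)"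
    and counit_right: "A \<in> Obj C
      \<Longrightarrow> FArr (Ftr W) (counit W A) \<cdot>\<^bsub>C\<^esub> comult W A = Idn C (FObj (Ftr W) A)"
    and coassoc: "A \<in> Obj C
      \<Longrightarrow> comult W (FObj (Ftr W) A) \<cdot>\<^bsub>C\<^esub> comult W A
        = FArr (Ftr W) (comult W A) \<cdot>\<^bsub>C\<^esub> comult W A"

definition is_coalgebra :: "('o, 'a) cat \<Rightarrow> ('o, 'a) comonad_data \<Rightarrow> 'o \<times> 'a \<Rightarrow> bool" where
  "is_coalgebra C W = (\<lambda>(A, \<alpha>).
    A \<in> Obj C \<and> \<alpha> \<in> Hom C A (FObj (Ftr W) A) \<and>
    counit W A \<cdot>\<^bsub>C\<^esub> \<alpha> = Idn C A \<and>
    comult W A \<cdot>\<^bsub>C\<^esub> \<alpha> = FArr (Ftr W) \<alpha> \<cdot>\<^bsub>C\<^esub> \<alpha>)"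

definition is_coalgebra_morphism ::
    "('o, 'a) cat \<Rightarrow> ('o, 'a) comonad_data \<Rightarrow> 'o \<times> 'a \<Rightarrow> 'o \<times> 'a \<Rightarrow> 'a \<Rightarrow> bool" where
  "is_coalgebra_morphism C W = (\<lambda>(A, \<alpha>) (B, \<beta>) f.
    f \<in> Hom C A B \<and> \<beta> \<cdot>\<^bsub>C\<^esub> f = FArr (Ftr W) f \<cdot>\<^bsub>C\<^esub> \<alpha>)"

text \<open>
  One underlying arrow may be a morphism between several pairs of coalgebras, so an arrow of
  \<open>EM C W\<close> is a triple recording its source and target coalgebra along with it.
\<close>

definition EM :: "('o, 'a) cat \<Rightarrow> ('o, 'a) comonad_data
    \<Rightarrow> ('o \<times> 'a, ('o \<times> 'a) \<times> 'a \<times> ('o \<times> 'a)) cat" where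
  "EM C W =
    \<lparr>Obj = {X. is_coalgebra C W X},
     Arr = {(X, f, Y). is_coalgebra C W X \<and> is_coalgebra C W Y \<and> is_coalgebra_morphism C W X Y f},
     Dom = (\<lambda>(X, f, Y). X),
     Cod = (\<lambda>(X, f, Y). Y),
     Idn = (\<lambda>X. (X, Idn C (fst X), X)),
     Cmp = (\<lambda>(Y, g, Z) (X, f, Y'). (X, g \<cdot>\<^bsub>C\<^esub> f, Z))\<rparr>"

definition cofree :: "('o, 'a) cat \<Rightarrow> ('o, 'a) comonad_data
    \<Rightarrow> ('o, 'a, 'o \<times> 'a, ('o \<times> 'a) \<times> 'a \<times> ('o \<times> 'a)) ftr" where
  "cofree C W =
    \<lparr>FObj = (\<lambda>A. (FObj (Ftr W) A, comult W A)),
     FArr = (\<lambda>f. ((FObj (Ftr W) (Dom C f), comult W (Dom C f)),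
                  FArr (Ftr W) f,
                  (FObj (Ftr W) (Cod C f), comult W (Cod C f))))\<rparr>"

section \<open>Kleisli laws\<close>

locale kleisli_law =
  nat_trans "prod_cat I \<C>" D "Ftr V \<circ>\<^sub>F H" "H \<circ>\<^sub>F prod_ftr I (\<lambda>i. Ftr (W i))" \<kappa>
  for I :: "'i set" and \<C> :: "'i \<Rightarrow> ('o, 'a) cat" and W :: "'i \<Rightarrow> ('o, 'a) comonad_data"
    and D :: "('p, 'b) cat" and V :: "('p, 'b) comonad_data"
    and H :: "('i \<Rightarrow> 'o, 'i \<Rightarrow> 'a, 'p, 'b) ftr" and \<kappa> :: "('i \<Rightarrow> 'o) \<Rightarrow> 'b" +
  assumes counit_law: "A \<in> Obj (prod_cat I \<C>)
      \<Longrightarrow> FArr H (\<lambda>i\<in>I. counit (W i) (A i)) \<cdot>\<^bsub>D\<^esub> \<kappa> A = counit V (FObj H A)"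
    and comult_law: "A \<in> Obj (prod_cat I \<C>)
      \<Longrightarrow> FArr H (\<lambda>i\<in>I. comult (W i) (A i)) \<cdot>\<^bsub>D\<^esub> \<kappa> A
        = \<kappa> (\<lambda>i\<in>I. FObj (Ftr (W i)) (A i)) \<cdot>\<^bsub>D\<^esub> FArr (Ftr V) (\<kappa> A) \<cdot>\<^bsub>D\<^esub> comult V (FObj H A)"

end

theory Submission
  imports Defs
begin

text \<open>
  For coalgebras \<open>(A\<^sub>i, \<alpha>\<^sub>i)\<close> let \<open>H'(A, \<alpha>)\<close> be the equaliser in \<open>EM D V\<close> of the two morphisms
  \<open>V (H \<alpha>)\<close> and \<open>V \<kappa>\<^sub>A \<cdot> \<delta>\<close> from the cofree coalgebra on \<open>H A\<close> to the one on \<open>H (W A)\<close>; both are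
  natural in \<open>(A, \<alpha>)\<close>.  At a tuple of cofree coalgebras \<open>(W X, \<delta>)\<close> this pair has a split
  equaliser, namely \<open>V \<kappa>\<^sub>X \<cdot> \<delta>\<close> with splittings \<open>V (H \<epsilon>)\<close> and \<open>V (H (W \<epsilon>))\<close>, whose domain is the
  cofree coalgebra on \<open>H X\<close>.
\<close>

section \<open>Categories with equalisers\<close>

lemma Hom_Dom: "f \<in> Hom C A B \<Longrightarrow> Dom C f = A"
  and Hom_Cod: "f \<in> Hom C A B \<Longrightarrow> Cod C f = B"
  and Hom_Arr: "f \<in> Hom C A B \<Longrightarrow> f \<in> Arr C"
  by (auto simp: Hom_def)

lemma (in category) Hom_Obj:
  assumes "f \<in> Hom C A B" shows "A \<in> Obj C" "B \<in> Obj C"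
  using assms Dom_Obj Cod_Obj by (auto simp: Hom_def)

lemma is_equaliser_Hom:
  assumes "is_equaliser C f g e" "f \<in> Hom C A B"
  shows "e \<in> Hom C (Dom C e) A"
  using assms by (auto simp: is_equaliser_def Hom_def)

lemma is_equaliser_equalises: "is_equaliser C f g e \<Longrightarrow> f \<cdot>\<^bsub>C\<^esub> e = g \<cdot>\<^bsub>C\<^esub> e"
  by (simp add: is_equaliser_def)

lemma is_equaliser_lift:
  assumes "is_equaliser C f g e" "f \<in> Hom C A B" "h \<in> Hom C Z A" "f \<cdot>\<^bsub>C\<^esub> h = g \<cdot>\<^bsub>C\<^esub> h"
  shows "\<exists>!u. u \<in> Hom C Z (Dom C e) \<and> e \<cdot>\<^bsub>C\<^esub> u = h"
proof -
  have "h \<in> Arr C" "Cod C h = Dom C f" "Dom C h = Z"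
    using assms(2,3) by (simp_all add: Hom_def)
  then show ?thesis
    using assms(1,4) unfolding is_equaliser_def by blast
qed

text \<open>Equalisers are monic: \<open>u\<close> and \<open>v\<close> are two factorisations
  through \<open>e\<close> of one arrow that equalises the pair, and such factorisations are
  unique.\<close>

lemma (in category) is_equaliser_cancel:
  assumes eq: "is_equaliser C f g e" and f: "f \<in> Hom C A B" and g: "g \<in> Hom C A B"
    and u: "u \<in> Hom C Z (Dom C e)" and v: "v \<in> Hom C Z (Dom C e)"
    and uv: "e \<cdot>\<^bsub>C\<^esub> u = e \<cdot>\<^bsub>C\<^esub> v"
  shows "u = v"
proof -
  have e: "e \<in> Hom C (Dom C e) A" using is_equaliser_Hom[OF eq f] .
  have "f \<cdot>\<^bsub>C\<^esub> (e \<cdot>\<^bsub>C\<^esub> u) = g \<cdot>\<^bsub>C\<^esub> (e \<cdot>\<^bsub>C\<^esub> u)"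
    using Cmp_assoc[OF u e f] Cmp_assoc[OF u e g] is_equaliser_equalises[OF eq] by simp
  then show ?thesis
    using is_equaliser_lift[OF eq f Cmp_Hom[OF u e]] u v uv by metis
qed

text \<open>Equalisers of natural transformations are formed objectwise: choose \<open>q A\<close>
  at each object \<open>A\<close> and let \<open>L\<close> send \<open>A\<close> to its domain. The
  arrow part is induced by the universal property, and since each \<open>q B\<close> is monic, the
  functor laws for \<open>L\<close> follow from those for \<open>G\<close>.\<close>

lemma equaliser_functor:
  assumes "nat_trans Q E G G' \<phi>" and "nat_trans Q E G G' \<psi>" and "has_equalisers E"
  shows "\<exists>L q. is_functor Q E L \<and> nat_trans Q E L G q \<and>
    (\<forall>A \<in> Obj Q. is_equaliser E (\<phi> A) (\<psi> A) (q A))"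
proof -
  interpret Q: category Q using assms(1) by (simp add: nat_trans_def is_functor_def)
  interpret E: category E using assms(1) by (simp add: nat_trans_def is_functor_def)
  interpret \<phi>: nat_trans Q E G G' \<phi> by fact
  interpret \<psi>: nat_trans Q E G G' \<psi> by fact
  have "\<exists>e. is_equaliser E (\<phi> A) (\<psi> A) e" if "A \<in> Obj Q" for A
    using assms(3) \<phi>.component[OF that] \<psi>.component[OF that] E.Hom_Obj[OF \<phi>.component[OF that]]
    unfolding has_equalisers_def by blast
  then obtain q where q: "\<And>A. A \<in> Obj Q \<Longrightarrow> is_equaliser E (\<phi> A) (\<psi> A) (q A)"
    by metis
  have qH: "q A \<in> Hom E (Dom E (q A)) (FObj G A)" if "A \<in> Obj Q" for A
    using is_equaliser_Hom[OF q[OF that] \<phi>.component[OF that]] .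
  have cancel: "u = v" if "B \<in> Obj Q" "u \<in> Hom E Z (Dom E (q B))" "v \<in> Hom E Z (Dom E (q B))"
    "q B \<cdot>\<^bsub>E\<^esub> u = q B \<cdot>\<^bsub>E\<^esub> v" for B u v Z
    using E.is_equaliser_cancel[OF q \<phi>.component \<psi>.component] that by blast
  have "\<exists>u. u \<in> Hom E (Dom E (q A)) (Dom E (q B)) \<and> q B \<cdot>\<^bsub>E\<^esub> u = FArr G h \<cdot>\<^bsub>E\<^esub> q A"
    if h: "h \<in> Hom Q A B" for h A B
  proof -
    have A: "A \<in> Obj Q" and B: "B \<in> Obj Q" using Q.Hom_Obj[OF h] .
    note Gh = \<phi>.F.FArr_Hom[OF h] and G'h = \<phi>.G.FArr_Hom[OF h]
    \<comment> \<open>\<open>FArr G h\<close> followed by \<open>\<phi> B\<close> or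
      \<open>\<psi> B\<close> is, by naturality, \<open>\<phi> A\<close> or \<open>\<psi> A\<close>
      followed by \<open>FArr G' h\<close>, and \<open>q A\<close> equalises the latter pair. So the
      arrow factors through \<open>q B\<close>.\<close>
    have "\<phi> B \<cdot>\<^bsub>E\<^esub> (FArr G h \<cdot>\<^bsub>E\<^esub> q A) = FArr G' h \<cdot>\<^bsub>E\<^esub> (\<phi> A \<cdot>\<^bsub>E\<^esub> q A)"
      using E.Cmp_assoc[OF qH[OF A] Gh \<phi>.component[OF B]]
        E.Cmp_assoc[OF qH[OF A] \<phi>.component[OF A] G'h] \<phi>.naturality[OF h] by simp
    also have "\<dots> = \<psi> B \<cdot>\<^bsub>E\<^esub> (FArr G h \<cdot>\<^bsub>E\<^esub> q A)"
      using E.Cmp_assoc[OF qH[OF A] Gh \<psi>.component[OF B]]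
        E.Cmp_assoc[OF qH[OF A] \<psi>.component[OF A] G'h] \<psi>.naturality[OF h]
        is_equaliser_equalises[OF q[OF A]] by simp
    finally show ?thesis
      using is_equaliser_lift[OF q[OF B] \<phi>.component[OF B] E.Cmp_Hom[OF qH[OF A] Gh]] by blast
  qed
  \<comment> \<open>An arrow determines its domain and codomain, so the induced arrow can be chosen
    as a function of \<open>h\<close> alone, which is the shape that \<open>FArr\<close>
    requires.\<close>
  then have "\<exists>u. \<forall>A B. h \<in> Hom Q A B \<longrightarrow>
      u \<in> Hom E (Dom E (q A)) (Dom E (q B)) \<and> q B \<cdot>\<^bsub>E\<^esub> u = FArr G h \<cdot>\<^bsub>E\<^esub> q A" for h
    by (metis Hom_Dom Hom_Cod)
  then obtain m where m: "\<And>h A B. h \<in> Hom Q A B \<Longrightarrow> m h \<in> Hom E (Dom E (q A)) (Dom E (q B))"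
    and qm: "\<And>h A B. h \<in> Hom Q A B \<Longrightarrow> q B \<cdot>\<^bsub>E\<^esub> m h = FArr G h \<cdot>\<^bsub>E\<^esub> q A"
    by metis
  define L where "L = \<lparr>FObj = (\<lambda>A. Dom E (q A)), FArr = m\<rparr>"
  have L: "is_functor Q E L"
  proof
    fix A assume A: "A \<in> Obj Q"
    show LA: "FObj L A \<in> Obj E" using E.Hom_Obj[OF qH[OF A]] by (simp add: L_def)
    have "q A \<cdot>\<^bsub>E\<^esub> m (Idn Q A) = q A \<cdot>\<^bsub>E\<^esub> Idn E (Dom E (q A))"
      using qm[OF Q.Idn_Hom[OF A]] \<phi>.F.FArr_Idn[OF A] E.Idn_left[OF qH[OF A]]
        E.Idn_right[OF qH[OF A]] by simp
    then show "FArr L (Idn Q A) = Idn E (FObj L A)"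
      using cancel[OF A m[OF Q.Idn_Hom[OF A]]] E.Idn_Hom[OF LA] by (simp add: L_def)
  next
    fix f A B assume "f \<in> Hom Q A B"
    then show "FArr L f \<in> Hom E (FObj L A) (FObj L B)" using m by (simp add: L_def)
  next
    fix f g A B Z assume f: "f \<in> Hom Q A B" and g: "g \<in> Hom Q B Z"
    have A: "A \<in> Obj Q" and B: "B \<in> Obj Q" and Z: "Z \<in> Obj Q"
      using Q.Hom_Obj[OF f] Q.Hom_Obj[OF g] by auto
    note Gf = \<phi>.F.FArr_Hom[OF f] and Gg = \<phi>.F.FArr_Hom[OF g]
    have "q Z \<cdot>\<^bsub>E\<^esub> (m g \<cdot>\<^bsub>E\<^esub> m f) = FArr G g \<cdot>\<^bsub>E\<^esub> (q B \<cdot>\<^bsub>E\<^esub> m f)"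
      using E.Cmp_assoc[OF m[OF f] m[OF g] qH[OF Z]] E.Cmp_assoc[OF m[OF f] qH[OF B] Gg] qm[OF g]
      by simp
    also have "\<dots> = FArr G (g \<cdot>\<^bsub>Q\<^esub> f) \<cdot>\<^bsub>E\<^esub> q A"
      using E.Cmp_assoc[OF qH[OF A] Gf Gg] qm[OF f] \<phi>.F.FArr_Cmp[OF f g] by simp
    also have "\<dots> = q Z \<cdot>\<^bsub>E\<^esub> m (g \<cdot>\<^bsub>Q\<^esub> f)"
      using qm[OF Q.Cmp_Hom[OF f g]] by simp
    finally show "FArr L (g \<cdot>\<^bsub>Q\<^esub> f) = FArr L g \<cdot>\<^bsub>E\<^esub> FArr L f"
      using cancel[OF Z E.Cmp_Hom[OF m[OF f] m[OF g]] m[OF Q.Cmp_Hom[OF f g]]] by (simp add: L_def)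
  qed
  then interpret L: is_functor Q E L .
  have "nat_trans Q E L G q"
  proof
    fix A assume "A \<in> Obj Q"
    then show "q A \<in> Hom E (FObj L A) (FObj G A)" using qH by (simp add: L_def)
  next
    fix f A B assume "f \<in> Hom Q A B"
    then show "q B \<cdot>\<^bsub>E\<^esub> FArr L f = FArr G f \<cdot>\<^bsub>E\<^esub> q A" using qm by (simp add: L_def)
  qed
  then show ?thesis using L q by blast
qed

text \<open>A fork \<open>e\<close> with splittings \<open>s\<close> and \<open>t\<close> is itself
  an equaliser of \<open>f\<close> and \<open>g\<close>, hence isomorphic to any other one,
  \<open>q\<close>. The comparison is given explicitly as \<open>s\<close> after \<open>q\<close>;
  its inverse is the factorisation \<open>u\<close> of \<open>e\<close> through
  \<open>q\<close>.\<close>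

lemma (in category) split_equaliser_iso:
  assumes eq: "is_equaliser C f g q" and f: "f \<in> Hom C A B" and g: "g \<in> Hom C A B"
    and e: "e \<in> Hom C S A" and s: "s \<in> Hom C A S" and t: "t \<in> Hom C B A"
    and fe: "f \<cdot>\<^bsub>C\<^esub> e = g \<cdot>\<^bsub>C\<^esub> e" and se: "s \<cdot>\<^bsub>C\<^esub> e = Idn C S"
    and tf: "t \<cdot>\<^bsub>C\<^esub> f = Idn C A" and tg: "t \<cdot>\<^bsub>C\<^esub> g = e \<cdot>\<^bsub>C\<^esub> s"
  shows "iso_arr C (s \<cdot>\<^bsub>C\<^esub> q)"
proof -
  have q: "q \<in> Hom C (Dom C q) A" using is_equaliser_Hom[OF eq f] .
  obtain u where u: "u \<in> Hom C S (Dom C q)" and qu: "q \<cdot>\<^bsub>C\<^esub> u = e"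
    using is_equaliser_lift[OF eq f e fe] by blast
  have sq: "s \<cdot>\<^bsub>C\<^esub> q \<in> Hom C (Dom C q) S" using Cmp_Hom[OF q s] .
  \<comment> \<open>Replace \<open>e\<close> after \<open>s\<close> by \<open>t\<close> after
    \<open>g\<close>, exchange \<open>g\<close> for \<open>f\<close> in front of \<open>q\<close>,
    and cancel \<open>t\<close> against \<open>f\<close>.\<close>
  have "e \<cdot>\<^bsub>C\<^esub> (s \<cdot>\<^bsub>C\<^esub> q) = t \<cdot>\<^bsub>C\<^esub> (f \<cdot>\<^bsub>C\<^esub> q)"
    using Cmp_assoc[OF q s e] Cmp_assoc[OF q g t] tg is_equaliser_equalises[OF eq] by simp
  also have "\<dots> = q"
    using Cmp_assoc[OF q f t] tf Idn_left[OF q] by simp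
  finally have "q \<cdot>\<^bsub>C\<^esub> (u \<cdot>\<^bsub>C\<^esub> (s \<cdot>\<^bsub>C\<^esub> q)) = q \<cdot>\<^bsub>C\<^esub> Idn C (Dom C q)"
    using Cmp_assoc[OF sq u q] qu Idn_right[OF q] by simp
  then have "u \<cdot>\<^bsub>C\<^esub> (s \<cdot>\<^bsub>C\<^esub> q) = Idn C (Dom C q)"
    using is_equaliser_cancel[OF eq f g Cmp_Hom[OF sq u] Idn_Hom] Hom_Obj[OF q] by blast
  moreover have "(s \<cdot>\<^bsub>C\<^esub> q) \<cdot>\<^bsub>C\<^esub> u = Idn C S"
    using Cmp_assoc[OF u q s] qu se by simp
  ultimately show ?thesis
    unfolding iso_arr_def using u Hom_Arr[OF sq] Hom_Dom[OF sq] Hom_Cod[OF sq] by auto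
qed

section \<open>Functors and products of categories\<close>

lemma FObj_comp_ftr [simp]: "FObj (G \<circ>\<^sub>F F) A = FObj G (FObj F A)"
  and FArr_comp_ftr [simp]: "FArr (G \<circ>\<^sub>F F) f = FArr G (FArr F f)"
  by (simp_all add: comp_ftr_def)

lemma comp_ftr_assoc: "(H \<circ>\<^sub>F G) \<circ>\<^sub>F F = H \<circ>\<^sub>F (G \<circ>\<^sub>F F)"
  by (simp add: comp_ftr_def)

lemma comp_ftr_id_ftr: "F \<circ>\<^sub>F id_ftr = F"
  by (simp add: comp_ftr_def id_ftr_def)

lemma is_functor_comp_ftr:
  assumes "is_functor A B F" and "is_functor B C G"
  shows "is_functor A C (G \<circ>\<^sub>F F)"
proof -
  interpret F: is_functor A B F by fact
  interpret G: is_functor B C G by fact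
  show ?thesis
    by unfold_locales
      (auto intro: F.FObj_Obj G.FObj_Obj F.FArr_Hom G.FArr_Hom
        simp: F.FArr_Idn G.FArr_Idn F.FObj_Obj F.FArr_Cmp G.FArr_Cmp[OF F.FArr_Hom F.FArr_Hom])
qed

lemma nat_trans_vcomp:
  assumes "nat_trans C D F G \<eta>" and "nat_trans C D G K \<theta>"
  shows "nat_trans C D F K (\<lambda>A. \<theta> A \<cdot>\<^bsub>D\<^esub> \<eta> A)"
proof -
  interpret \<eta>: nat_trans C D F G \<eta> by fact
  interpret \<theta>: nat_trans C D G K \<theta> by fact
  note assoc = \<eta>.F.D.Cmp_assoc
  show ?thesis
  proof
    fix A assume "A \<in> Obj C"
    then show "\<theta> A \<cdot>\<^bsub>D\<^esub> \<eta> A \<in> Hom D (FObj F A) (FObj K A)"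
      using \<eta>.F.D.Cmp_Hom \<eta>.component \<theta>.component by blast
  next
    fix f A B assume f: "f \<in> Hom C A B"
    have A: "A \<in> Obj C" and B: "B \<in> Obj C" using \<eta>.F.C.Hom_Obj[OF f] .
    note \<eta>AB = \<eta>.component[OF A] \<eta>.component[OF B] and \<theta>AB = \<theta>.component[OF A] \<theta>.component[OF B]
    show "(\<theta> B \<cdot>\<^bsub>D\<^esub> \<eta> B) \<cdot>\<^bsub>D\<^esub> FArr F f = FArr K f \<cdot>\<^bsub>D\<^esub> (\<theta> A \<cdot>\<^bsub>D\<^esub> \<eta> A)"
      using assoc[OF \<eta>.F.FArr_Hom[OF f] \<eta>AB(2) \<theta>AB(2)] \<eta>.naturality[OF f]
        assoc[OF \<eta>AB(1) \<eta>.G.FArr_Hom[OF f] \<theta>AB(2)] \<theta>.naturality[OF f]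
        assoc[OF \<eta>AB(1) \<theta>AB(1) \<theta>.G.FArr_Hom[OF f]] by simp
  qed
qed

lemma nat_trans_whisker_right:
  assumes "is_functor A B F" and "nat_trans B C G K \<eta>"
  shows "nat_trans A C (G \<circ>\<^sub>F F) (K \<circ>\<^sub>F F) (\<lambda>X. \<eta> (FObj F X))"
proof -
  interpret F: is_functor A B F by fact
  interpret \<eta>: nat_trans B C G K \<eta> by fact
  interpret GF: is_functor A C "G \<circ>\<^sub>F F"
    by (rule is_functor_comp_ftr[OF assms(1) \<eta>.F.is_functor_axioms])
  interpret KF: is_functor A C "K \<circ>\<^sub>F F"
    by (rule is_functor_comp_ftr[OF assms(1) \<eta>.G.is_functor_axioms])
  show ?thesis
    by unfold_locales
      (simp_all add: \<eta>.component F.FObj_Obj \<eta>.naturality[OF F.FArr_Hom])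
qed

lemma nat_trans_whisker_left:
  assumes "nat_trans A B F G \<eta>" and "is_functor B C K"
  shows "nat_trans A C (K \<circ>\<^sub>F F) (K \<circ>\<^sub>F G) (\<lambda>X. FArr K (\<eta> X))"
proof -
  interpret \<eta>: nat_trans A B F G \<eta> by fact
  interpret K: is_functor B C K by fact
  interpret KF: is_functor A C "K \<circ>\<^sub>F F"
    by (rule is_functor_comp_ftr[OF \<eta>.F.is_functor_axioms assms(2)])
  interpret KG: is_functor A C "K \<circ>\<^sub>F G"
    by (rule is_functor_comp_ftr[OF \<eta>.G.is_functor_axioms assms(2)])
  show ?thesis
  proof
    fix X assume "X \<in> Obj A"
    then show "FArr K (\<eta> X) \<in> Hom C (FObj (K \<circ>\<^sub>F F) X) (FObj (K \<circ>\<^sub>F G) X)"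
      using K.FArr_Hom \<eta>.component by simp
  next
    fix f X Y assume f: "f \<in> Hom A X Y"
    have X: "X \<in> Obj A" and Y: "Y \<in> Obj A" using \<eta>.F.C.Hom_Obj[OF f] .
    show "FArr K (\<eta> Y) \<cdot>\<^bsub>C\<^esub> FArr (K \<circ>\<^sub>F F) f = FArr (K \<circ>\<^sub>F G) f \<cdot>\<^bsub>C\<^esub> FArr K (\<eta> X)"
      using K.FArr_Cmp[OF \<eta>.F.FArr_Hom[OF f] \<eta>.component[OF Y]]
        K.FArr_Cmp[OF \<eta>.component[OF X] \<eta>.G.FArr_Hom[OF f]] \<eta>.naturality[OF f] by simp
  qed
qed

section \<open>Products of categories, functors and natural transformations\<close>

lemma FObj_prod_ftr: "FObj (prod_ftr I F) A = (\<lambda>i\<in>I. FObj (F i) (A i))"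
  and FArr_prod_ftr: "FArr (prod_ftr I F) f = (\<lambda>i\<in>I. FArr (F i) (f i))"
  by (simp_all add: prod_ftr_def)

lemma Obj_prod_cat: "Obj (prod_cat I \<C>) = (\<Pi>\<^sub>E i\<in>I. Obj (\<C> i))"
  and Idn_prod_cat [simp]: "Idn (prod_cat I \<C>) A = (\<lambda>i\<in>I. Idn (\<C> i) (A i))"
  and Cmp_prod_cat [simp]: "g \<cdot>\<^bsub>prod_cat I \<C>\<^esub> f = (\<lambda>i\<in>I. g i \<cdot>\<^bsub>\<C> i\<^esub> f i)"
  by (simp_all add: prod_cat_def)

text \<open>\<open>Dom\<close> and \<open>Cod\<close> of a tuple are restricted to \<open>I\<close>,
  which forces \<open>A\<close> and \<open>B\<close> to be extensional. With this, laws in the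
  product category reduce to laws in each component.\<close>

lemma Hom_prod_cat: "f \<in> Hom (prod_cat I \<C>) A B \<longleftrightarrow>
    f \<in> extensional I \<and> A \<in> extensional I \<and> B \<in> extensional I \<and>
    (\<forall>i\<in>I. f i \<in> Hom (\<C> i) (A i) (B i))"
  unfolding Hom_def prod_cat_def
  by (auto simp: PiE_iff extensional_def restrict_def fun_eq_iff)

lemma category_prod_cat:
  assumes "\<And>i. i \<in> I \<Longrightarrow> category (\<C> i)"
  shows "category (prod_cat I \<C>)"
proof
  fix f assume "f \<in> Arr (prod_cat I \<C>)"
  then show "Dom (prod_cat I \<C>) f \<in> Obj (prod_cat I \<C>)" "Cod (prod_cat I \<C>) f \<in> Obj (prod_cat I \<C>)"
    using category.Dom_Obj[OF assms] category.Cod_Obj[OF assms] by (auto simp: prod_cat_def PiE_iff)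
next
  fix A assume "A \<in> Obj (prod_cat I \<C>)"
  then show "Idn (prod_cat I \<C>) A \<in> Hom (prod_cat I \<C>) A A"
    using category.Idn_Hom[OF assms] by (auto simp: Obj_prod_cat Hom_prod_cat PiE_iff)
next
  fix f g A B E assume "f \<in> Hom (prod_cat I \<C>) A B" "g \<in> Hom (prod_cat I \<C>) B E"
  then show "g \<cdot>\<^bsub>prod_cat I \<C>\<^esub> f \<in> Hom (prod_cat I \<C>) A E"
    using category.Cmp_Hom[OF assms] by (auto simp: Hom_prod_cat)
next
  fix f A B assume "f \<in> Hom (prod_cat I \<C>) A B"
  then show "Idn (prod_cat I \<C>) B \<cdot>\<^bsub>prod_cat I \<C>\<^esub> f = f"
    "f \<cdot>\<^bsub>prod_cat I \<C>\<^esub> Idn (prod_cat I \<C>) A = f"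
    using category.Idn_left[OF assms] category.Idn_right[OF assms]
    by (auto simp: Hom_prod_cat intro!: extensionalityI[of _ I])
next
  fix f g h A B E G
  assume "f \<in> Hom (prod_cat I \<C>) A B" "g \<in> Hom (prod_cat I \<C>) B E" "h \<in> Hom (prod_cat I \<C>) E G"
  then show "(h \<cdot>\<^bsub>prod_cat I \<C>\<^esub> g) \<cdot>\<^bsub>prod_cat I \<C>\<^esub> f = h \<cdot>\<^bsub>prod_cat I \<C>\<^esub> (g \<cdot>\<^bsub>prod_cat I \<C>\<^esub> f)"
    using category.Cmp_assoc[OF assms]
    by (fastforce simp: Hom_prod_cat intro!: extensionalityI[of _ I])
qed

lemma is_functor_prod_ftr:
  assumes F: "\<And>i. i \<in> I \<Longrightarrow> is_functor (\<C> i) (\<D> i) (F i)"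
  shows "is_functor (prod_cat I \<C>) (prod_cat I \<D>) (prod_ftr I F)"
proof -
  interpret C: category "prod_cat I \<C>"
    using F by (auto intro: category_prod_cat simp: is_functor_def)
  interpret D: category "prod_cat I \<D>"
    using F by (auto intro: category_prod_cat simp: is_functor_def)
  show ?thesis
  proof
    fix A assume "A \<in> Obj (prod_cat I \<C>)"
    then show "FObj (prod_ftr I F) A \<in> Obj (prod_cat I \<D>)"
      "FArr (prod_ftr I F) (Idn (prod_cat I \<C>) A) = Idn (prod_cat I \<D>) (FObj (prod_ftr I F) A)"
      using is_functor.FObj_Obj[OF F] is_functor.FArr_Idn[OF F]
      by (auto simp: Obj_prod_cat FObj_prod_ftr FArr_prod_ftr PiE_iff intro!: extensionalityI[of _ I])
  next
    fix f A B assume "f \<in> Hom (prod_cat I \<C>) A B"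
    then show "FArr (prod_ftr I F) f
        \<in> Hom (prod_cat I \<D>) (FObj (prod_ftr I F) A) (FObj (prod_ftr I F) B)"
      using is_functor.FArr_Hom[OF F] by (auto simp: Hom_prod_cat FObj_prod_ftr FArr_prod_ftr)
  next
    fix f g A B E assume "f \<in> Hom (prod_cat I \<C>) A B" "g \<in> Hom (prod_cat I \<C>) B E"
    then show "FArr (prod_ftr I F) (g \<cdot>\<^bsub>prod_cat I \<C>\<^esub> f)
        = FArr (prod_ftr I F) g \<cdot>\<^bsub>prod_cat I \<D>\<^esub> FArr (prod_ftr I F) f"
      using is_functor.FArr_Cmp[OF F]
      by (fastforce simp: Hom_prod_cat FArr_prod_ftr intro!: extensionalityI[of _ I])
  qed
qed

lemma nat_trans_prod:
  assumes \<eta>: "\<And>i. i \<in> I \<Longrightarrow> nat_trans (\<C> i) (\<D> i) (F i) (G i) (\<eta> i)"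
  shows "nat_trans (prod_cat I \<C>) (prod_cat I \<D>) (prod_ftr I F) (prod_ftr I G)
    (\<lambda>A. \<lambda>i\<in>I. \<eta> i (A i))"
proof -
  interpret F: is_functor "prod_cat I \<C>" "prod_cat I \<D>" "prod_ftr I F"
    using \<eta> by (auto intro: is_functor_prod_ftr simp: nat_trans_def)
  interpret G: is_functor "prod_cat I \<C>" "prod_cat I \<D>" "prod_ftr I G"
    using \<eta> by (auto intro: is_functor_prod_ftr simp: nat_trans_def)
  show ?thesis
  proof
    fix A assume "A \<in> Obj (prod_cat I \<C>)"
    then show "(\<lambda>i\<in>I. \<eta> i (A i))
        \<in> Hom (prod_cat I \<D>) (FObj (prod_ftr I F) A) (FObj (prod_ftr I G) A)"
      using nat_trans.component[OF \<eta>] by (auto simp: Obj_prod_cat Hom_prod_cat FObj_prod_ftr PiE_iff)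
  next
    fix f A B assume "f \<in> Hom (prod_cat I \<C>) A B"
    then show "(\<lambda>i\<in>I. \<eta> i (B i)) \<cdot>\<^bsub>prod_cat I \<D>\<^esub> FArr (prod_ftr I F) f
        = FArr (prod_ftr I G) f \<cdot>\<^bsub>prod_cat I \<D>\<^esub> (\<lambda>i\<in>I. \<eta> i (A i))"
      using nat_trans.naturality[OF \<eta>]
      by (auto simp: Hom_prod_cat FArr_prod_ftr intro!: extensionalityI[of _ I])
  qed
qed

section \<open>Coalgebras\<close>

lemma Hom_EM: "\<phi> \<in> Hom (EM C W) X Y \<longleftrightarrow> (\<exists>f. \<phi> = (X, f, Y) \<and>
    is_coalgebra C W X \<and> is_coalgebra C W Y \<and> is_coalgebra_morphism C W X Y f)"
  by (auto simp: Hom_def EM_def)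

lemma Obj_EM: "Obj (EM C W) = {X. is_coalgebra C W X}"
  and Idn_EM: "Idn (EM C W) X = (X, Idn C (fst X), X)"
  and Cmp_EM: "(Y', g, Z) \<cdot>\<^bsub>EM C W\<^esub> (X, f, Y) = (X, g \<cdot>\<^bsub>C\<^esub> f, Z)"
  by (simp_all add: EM_def)

definition forget :: "('o \<times> 'a, ('o \<times> 'a) \<times> 'a \<times> ('o \<times> 'a), 'o, 'a) ftr" where
  "forget = \<lparr>FObj = fst, FArr = (\<lambda>(X, f, Y). f)\<rparr>"

lemma FObj_forget [simp]: "FObj forget X = fst X"
  and FArr_forget [simp]: "FArr forget (X, f, Y) = f"
  by (simp_all add: forget_def)

lemma FObj_cofree: "FObj (cofree C W) A = (FObj (Ftr W) A, comult W A)"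
  by (simp add: cofree_def)

lemma fst_FObj_cofree [simp]: "fst (FObj (cofree C W) A) = FObj (Ftr W) A"
  and snd_FObj_cofree [simp]: "snd (FObj (cofree C W) A) = comult W A"
  and FArr_forget_cofree [simp]: "FArr forget (FArr (cofree C W) f) = FArr (Ftr W) f"
  by (simp_all add: cofree_def forget_def)

lemma FArr_cofree: "f \<in> Hom C A B \<Longrightarrow>
    FArr (cofree C W) f = (FObj (cofree C W) A, FArr (Ftr W) f, FObj (cofree C W) B)"
  by (auto simp: cofree_def Hom_def)

text \<open>The coKleisli extension of \<open>k\<close> from \<open>W A\<close> to \<open>B\<close>:
  the unique coalgebra morphism between the cofree coalgebras whose composite with the counit at
  \<open>B\<close> is \<open>k\<close>. The object \<open>A\<close> is an argument because the
  domain of \<open>k\<close> shows only its image under the comonad.\<close>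

definition coextend :: "('o, 'a) cat \<Rightarrow> ('o, 'a) comonad_data \<Rightarrow> 'o \<Rightarrow> 'o \<Rightarrow> 'a
    \<Rightarrow> ('o \<times> 'a) \<times> 'a \<times> ('o \<times> 'a)" where
  "coextend C W A B k =
    (FObj (cofree C W) A, FArr (Ftr W) k \<cdot>\<^bsub>C\<^esub> comult W A, FObj (cofree C W) B)"

context comonad
begin

lemma comult_Hom: "A \<in> Obj C
    \<Longrightarrow> comult W A \<in> Hom C (FObj (Ftr W) A) (FObj (Ftr W) (FObj (Ftr W) A))"
  using comult.component by simp

lemma counit_Hom: "A \<in> Obj C \<Longrightarrow> counit W A \<in> Hom C (FObj (Ftr W) A) A"
  using counit.component by (simp add: id_ftr_def)

lemma comult_natural: "f \<in> Hom C A B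
    \<Longrightarrow> comult W B \<cdot>\<^bsub>C\<^esub> FArr (Ftr W) f = FArr (Ftr W) (FArr (Ftr W) f) \<cdot>\<^bsub>C\<^esub> comult W A"
  using comult.naturality by simp

text \<open>For the structure map \<open>comult W A\<close> the two coalgebra laws are
  \<open>counit_left\<close> and \<open>coassoc\<close>.\<close>

lemma is_coalgebra_cofree: "A \<in> Obj C \<Longrightarrow> is_coalgebra C W (FObj (cofree C W) A)"
  unfolding is_coalgebra_def FObj_cofree
  using FObj_Obj comult_Hom counit_left coassoc by simp

lemma is_coalgebra_morphism_Idn:
  "is_coalgebra C W X \<Longrightarrow> is_coalgebra_morphism C W X X (Idn C (fst X))"
  by (cases X)
    (auto simp: is_coalgebra_def is_coalgebra_morphism_def FArr_Idn Idn_Hom Idn_left Idn_right)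

lemma is_coalgebra_morphism_Cmp:
  assumes X: "is_coalgebra C W X" and Y: "is_coalgebra C W Y" and Z: "is_coalgebra C W Z"
    and f: "is_coalgebra_morphism C W X Y f" and g: "is_coalgebra_morphism C W Y Z g"
  shows "is_coalgebra_morphism C W X Z (g \<cdot>\<^bsub>C\<^esub> f)"
proof -
  obtain A \<alpha> B \<beta> G \<gamma> where XYZ: "X = (A, \<alpha>)" "Y = (B, \<beta>)" "Z = (G, \<gamma>)"
    by (metis surj_pair)
  have \<alpha>: "\<alpha> \<in> Hom C A (FObj (Ftr W) A)" and \<beta>: "\<beta> \<in> Hom C B (FObj (Ftr W) B)"
    and \<gamma>: "\<gamma> \<in> Hom C G (FObj (Ftr W) G)"
    using X Y Z by (auto simp: XYZ is_coalgebra_def)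
  have f': "f \<in> Hom C A B" and g': "g \<in> Hom C B G"
    and fe: "\<beta> \<cdot>\<^bsub>C\<^esub> f = FArr (Ftr W) f \<cdot>\<^bsub>C\<^esub> \<alpha>" and ge: "\<gamma> \<cdot>\<^bsub>C\<^esub> g = FArr (Ftr W) g \<cdot>\<^bsub>C\<^esub> \<beta>"
    using f g by (auto simp: XYZ is_coalgebra_morphism_def)
  have "\<gamma> \<cdot>\<^bsub>C\<^esub> (g \<cdot>\<^bsub>C\<^esub> f) = FArr (Ftr W) (g \<cdot>\<^bsub>C\<^esub> f) \<cdot>\<^bsub>C\<^esub> \<alpha>"
    using Cmp_assoc[OF f' g' \<gamma>] Cmp_assoc[OF f' \<beta> FArr_Hom[OF g']] fe ge
      Cmp_assoc[OF \<alpha> FArr_Hom[OF f'] FArr_Hom[OF g']] FArr_Cmp[OF f' g'] by simp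
  then show ?thesis
    using Cmp_Hom[OF f' g'] by (simp add: XYZ is_coalgebra_morphism_def)
qed

lemma is_coalgebra_morphism_Hom:
  "is_coalgebra_morphism C W X Y f \<Longrightarrow> f \<in> Hom C (fst X) (fst Y)"
  by (cases X; cases Y) (simp add: is_coalgebra_morphism_def)

lemma category_EM: "category (EM C W)"
proof
  fix f assume "f \<in> Arr (EM C W)"
  then show "Dom (EM C W) f \<in> Obj (EM C W)" "Cod (EM C W) f \<in> Obj (EM C W)"
    by (auto simp: EM_def)
next
  fix A assume "A \<in> Obj (EM C W)"
  then show "Idn (EM C W) A \<in> Hom (EM C W) A A"
    using is_coalgebra_morphism_Idn by (simp add: Obj_EM Idn_EM Hom_EM)
next
  fix f g A B E assume "f \<in> Hom (EM C W) A B" "g \<in> Hom (EM C W) B E"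
  then show "g \<cdot>\<^bsub>EM C W\<^esub> f \<in> Hom (EM C W) A E"
    by (auto simp: Hom_EM Cmp_EM intro: is_coalgebra_morphism_Cmp)
next
  fix f A B assume "f \<in> Hom (EM C W) A B"
  then show "Idn (EM C W) B \<cdot>\<^bsub>EM C W\<^esub> f = f" "f \<cdot>\<^bsub>EM C W\<^esub> Idn (EM C W) A = f"
    by (auto simp: Hom_EM Cmp_EM Idn_EM intro: Idn_left Idn_right dest!: is_coalgebra_morphism_Hom)
next
  fix f g h A B E G
  assume "f \<in> Hom (EM C W) A B" "g \<in> Hom (EM C W) B E" "h \<in> Hom (EM C W) E G"
  then show "(h \<cdot>\<^bsub>EM C W\<^esub> g) \<cdot>\<^bsub>EM C W\<^esub> f = h \<cdot>\<^bsub>EM C W\<^esub> (g \<cdot>\<^bsub>EM C W\<^esub> f)"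
    by (auto simp: Hom_EM Cmp_EM intro: Cmp_assoc dest!: is_coalgebra_morphism_Hom)
qed

lemma is_functor_forget: "is_functor (EM C W) C forget"
proof -
  interpret E: category "EM C W" by (rule category_EM)
  show ?thesis
  proof
    fix A assume "A \<in> Obj (EM C W)"
    then show "FObj forget A \<in> Obj C" by (auto simp: Obj_EM is_coalgebra_def)
    show "FArr forget (Idn (EM C W) A) = Idn C (FObj forget A)" by (simp add: Idn_EM)
  next
    fix f A B assume "f \<in> Hom (EM C W) A B"
    then show "FArr forget f \<in> Hom C (FObj forget A) (FObj forget B)"
      by (auto simp: Hom_EM intro: is_coalgebra_morphism_Hom)
  next
    fix f g A B E assume "f \<in> Hom (EM C W) A B" "g \<in> Hom (EM C W) B E"
    then show "FArr forget (g \<cdot>\<^bsub>EM C W\<^esub> f) = FArr forget g \<cdot>\<^bsub>C\<^esub> FArr forget f"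
      by (auto simp: Hom_EM Cmp_EM)
  qed
qed

lemma is_functor_cofree: "is_functor C (EM C W) (cofree C W)"
proof -
  interpret E: category "EM C W" by (rule category_EM)
  show ?thesis
  proof
    fix A assume A: "A \<in> Obj C"
    show "FObj (cofree C W) A \<in> Obj (EM C W)" using is_coalgebra_cofree[OF A] by (simp add: Obj_EM)
    show "FArr (cofree C W) (Idn C A) = Idn (EM C W) (FObj (cofree C W) A)"
      using FArr_cofree[OF Idn_Hom[OF A]] FArr_Idn[OF A] by (simp add: Idn_EM)
  next
    fix f A B assume f: "f \<in> Hom C A B"
    show "FArr (cofree C W) f \<in> Hom (EM C W) (FObj (cofree C W) A) (FObj (cofree C W) B)"
      using FArr_cofree[OF f] is_coalgebra_cofree Hom_Obj[OF f] FArr_Hom[OF f] comult_natural[OF f]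
      by (simp add: Hom_EM) (simp add: is_coalgebra_morphism_def FObj_cofree)
  next
    fix f g A B E assume f: "f \<in> Hom C A B" and g: "g \<in> Hom C B E"
    show "FArr (cofree C W) (g \<cdot>\<^bsub>C\<^esub> f) = FArr (cofree C W) g \<cdot>\<^bsub>EM C W\<^esub> FArr (cofree C W) f"
      using FArr_cofree[OF f] FArr_cofree[OF g] FArr_cofree[OF Cmp_Hom[OF f g]] FArr_Cmp[OF f g]
      by (simp add: Cmp_EM)
  qed
qed

text \<open>The naturality square of the structure maps at a coalgebra morphism is the equation that
  defines such a morphism.\<close>

lemma nat_trans_coalgebra: "nat_trans (EM C W) C forget (Ftr W \<circ>\<^sub>F forget) snd"
proof -
  interpret U: is_functor "EM C W" C forget by (rule is_functor_forget)
  interpret WU: is_functor "EM C W" C "Ftr W \<circ>\<^sub>F forget"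
    by (rule is_functor_comp_ftr[OF is_functor_forget is_functor_axioms])
  show ?thesis
    by unfold_locales
      (auto simp: Obj_EM is_coalgebra_def Hom_EM is_coalgebra_morphism_def)
qed

text \<open>Extension turns coKleisli composition into composition of coalgebra morphisms. This is
  what lets \<open>comult_law\<close> be read as an equation in \<open>EM\<close>.\<close>

lemma coextend_coextend:
  assumes A: "A \<in> Obj C" and k: "k \<in> Hom C (FObj (Ftr W) A) B"
    and l: "l \<in> Hom C (FObj (Ftr W) B) E"
  shows "coextend C W B E l \<cdot>\<^bsub>EM C W\<^esub> coextend C W A B k
    = coextend C W A E (l \<cdot>\<^bsub>C\<^esub> FArr (Ftr W) k \<cdot>\<^bsub>C\<^esub> comult W A)"
proof -
  have B: "B \<in> Obj C" using Hom_Obj[OF k] by simp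
  note \<delta>A = comult_Hom[OF A] and \<delta>B = comult_Hom[OF B] and \<delta>WA = comult_Hom[OF FObj_Obj[OF A]]
  note Wk = FArr_Hom[OF k] and Wl = FArr_Hom[OF l]
  note WWk = FArr_Hom[OF Wk] and W\<delta>A = FArr_Hom[OF \<delta>A] and k' = Cmp_Hom[OF \<delta>A Wk]
  have "(FArr (Ftr W) l \<cdot>\<^bsub>C\<^esub> comult W B) \<cdot>\<^bsub>C\<^esub> (FArr (Ftr W) k \<cdot>\<^bsub>C\<^esub> comult W A)
      = FArr (Ftr W) l \<cdot>\<^bsub>C\<^esub> ((comult W B \<cdot>\<^bsub>C\<^esub> FArr (Ftr W) k) \<cdot>\<^bsub>C\<^esub> comult W A)"
    using Cmp_assoc[OF k' \<delta>B Wl] Cmp_assoc[OF \<delta>A Wk \<delta>B] by simp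
  \<comment> \<open>Naturality moves the comultiplication in front of \<open>k\<close>;
    coassociativity then replaces its instance at \<open>FObj (Ftr W) A\<close> by the image of
    \<open>comult W A\<close>, which can be merged with \<open>k\<close>.\<close>
  also have "(comult W B \<cdot>\<^bsub>C\<^esub> FArr (Ftr W) k) \<cdot>\<^bsub>C\<^esub> comult W A
      = FArr (Ftr W) (FArr (Ftr W) k) \<cdot>\<^bsub>C\<^esub> (FArr (Ftr W) (comult W A) \<cdot>\<^bsub>C\<^esub> comult W A)"
    using comult_natural[OF k] Cmp_assoc[OF \<delta>A \<delta>WA WWk] coassoc[OF A] by simp
  also have "\<dots> = FArr (Ftr W) (FArr (Ftr W) k \<cdot>\<^bsub>C\<^esub> comult W A) \<cdot>\<^bsub>C\<^esub> comult W A"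
    using Cmp_assoc[OF \<delta>A W\<delta>A WWk] FArr_Cmp[OF \<delta>A Wk] by simp
  also have "FArr (Ftr W) l \<cdot>\<^bsub>C\<^esub> \<dots>
      = FArr (Ftr W) (l \<cdot>\<^bsub>C\<^esub> FArr (Ftr W) k \<cdot>\<^bsub>C\<^esub> comult W A) \<cdot>\<^bsub>C\<^esub> comult W A"
    using Cmp_assoc[OF \<delta>A FArr_Hom[OF k'] Wl] FArr_Cmp[OF k' l] by simp
  finally show ?thesis by (simp add: coextend_def Cmp_EM)
qed

lemma cofree_coextend:
  assumes A: "A \<in> Obj C" and k: "k \<in> Hom C (FObj (Ftr W) A) B" and h: "h \<in> Hom C B E"
  shows "FArr (cofree C W) h \<cdot>\<^bsub>EM C W\<^esub> coextend C W A B k = coextend C W A E (h \<cdot>\<^bsub>C\<^esub> k)"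
  using Cmp_assoc[OF comult_Hom[OF A] FArr_Hom[OF k] FArr_Hom[OF h]] FArr_Cmp[OF k h]
  by (simp add: FArr_cofree[OF h] coextend_def Cmp_EM)

text \<open>Naturality of \<open>comult W\<close> carries it past \<open>h\<close>. Together with
  \<open>cofree_coextend\<close>, composing with a cofree arrow on either side becomes a composition
  inside the extended arrow.\<close>

lemma coextend_cofree:
  assumes h: "h \<in> Hom C A B" and k: "k \<in> Hom C (FObj (Ftr W) B) E"
  shows "coextend C W B E k \<cdot>\<^bsub>EM C W\<^esub> FArr (cofree C W) h
    = coextend C W A E (k \<cdot>\<^bsub>C\<^esub> FArr (Ftr W) h)"
proof -
  have A: "A \<in> Obj C" and B: "B \<in> Obj C" using Hom_Obj[OF h] .
  note Wh = FArr_Hom[OF h]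
  show ?thesis
    using Cmp_assoc[OF Wh comult_Hom[OF B] FArr_Hom[OF k]] comult_natural[OF h]
      Cmp_assoc[OF comult_Hom[OF A] FArr_Hom[OF Wh] FArr_Hom[OF k]] FArr_Cmp[OF Wh k]
    by (simp add: FArr_cofree[OF h] coextend_def Cmp_EM)
qed

lemma coextend_counit:
  "A \<in> Obj C \<Longrightarrow> coextend C W A A (counit W A) = Idn (EM C W) (FObj (cofree C W) A)"
  using counit_right by (simp add: coextend_def Idn_EM)

text \<open>An extension is a composite of two coalgebra morphisms between cofree coalgebras:
  \<open>comult W A\<close>, by coassociativity, and the image of \<open>k\<close>, by naturality of
  \<open>comult W\<close>.\<close>

lemma coextend_Hom:
  assumes A: "A \<in> Obj C" and k: "k \<in> Hom C (FObj (Ftr W) A) B"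
  shows "coextend C W A B k \<in> Hom (EM C W) (FObj (cofree C W) A) (FObj (cofree C W) B)"
proof -
  have B: "B \<in> Obj C" using Hom_Obj[OF k] by simp
  note \<delta>A = comult_Hom[OF A]
  have "is_coalgebra_morphism C W (FObj (cofree C W) A)
      (FObj (cofree C W) (FObj (Ftr W) A)) (comult W A)"
    using \<delta>A coassoc[OF A] by (simp add: is_coalgebra_morphism_def FObj_cofree)
  moreover have "is_coalgebra_morphism C W (FObj (cofree C W) (FObj (Ftr W) A))
      (FObj (cofree C W) B) (FArr (Ftr W) k)"
    using FArr_Hom[OF k] comult_natural[OF k] by (simp add: is_coalgebra_morphism_def FObj_cofree)
  ultimately show ?thesis
    unfolding Hom_EM coextend_def
    using is_coalgebra_morphism_Cmp is_coalgebra_cofree A B FObj_Obj by blast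
qed

text \<open>Both sides of the naturality square are extensions, by \<open>coextend_cofree\<close>
  and \<open>cofree_coextend\<close>, and the arrows extended agree by naturality of
  \<kappa>.\<close>

lemma coextend_natural:
  assumes S: "is_functor B C S" and \<kappa>: "nat_trans B C (Ftr W \<circ>\<^sub>F S) T \<kappa>"
  shows "nat_trans B (EM C W) (cofree C W \<circ>\<^sub>F S) (cofree C W \<circ>\<^sub>F T)
    (\<lambda>X. coextend C W (FObj S X) (FObj T X) (\<kappa> X))"
proof -
  interpret B: category B using S by (simp add: is_functor_def)
  interpret S: is_functor B C S by fact
  interpret \<kappa>: nat_trans B C "Ftr W \<circ>\<^sub>F S" T \<kappa> by fact
  interpret FS: is_functor B "EM C W" "cofree C W \<circ>\<^sub>F S"
    by (rule is_functor_comp_ftr[OF S is_functor_cofree])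
  interpret FT: is_functor B "EM C W" "cofree C W \<circ>\<^sub>F T"
    by (rule is_functor_comp_ftr[OF \<kappa>.G.is_functor_axioms is_functor_cofree])
  have \<kappa>H: "\<kappa> X \<in> Hom C (FObj (Ftr W) (FObj S X)) (FObj T X)" if "X \<in> Obj B" for X
    using \<kappa>.component[OF that] by simp
  show ?thesis
  proof
    fix X assume "X \<in> Obj B"
    then show "coextend C W (FObj S X) (FObj T X) (\<kappa> X)
        \<in> Hom (EM C W) (FObj (cofree C W \<circ>\<^sub>F S) X) (FObj (cofree C W \<circ>\<^sub>F T) X)"
      using coextend_Hom[OF S.FObj_Obj \<kappa>H] by simp
  next
    fix f X Y assume f: "f \<in> Hom B X Y"
    have X: "X \<in> Obj B" and Y: "Y \<in> Obj B" using B.Hom_Obj[OF f] .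
    show "coextend C W (FObj S Y) (FObj T Y) (\<kappa> Y) \<cdot>\<^bsub>EM C W\<^esub> FArr (cofree C W \<circ>\<^sub>F S) f
        = FArr (cofree C W \<circ>\<^sub>F T) f \<cdot>\<^bsub>EM C W\<^esub> coextend C W (FObj S X) (FObj T X) (\<kappa> X)"
      using coextend_cofree[OF S.FArr_Hom[OF f] \<kappa>H[OF Y]] \<kappa>.naturality[OF f]
        cofree_coextend[OF S.FObj_Obj[OF X] \<kappa>H[OF X] \<kappa>.G.FArr_Hom[OF f]] by simp
  qed
qed

end

section \<open>Lifting along a Kleisli law\<close>

text \<open>\<open>kleisli_law\<close> constrains \<open>H\<close> and the comonad functors only
  through their composites; this locale adds that \<open>H\<close> is a functor and that
  \<open>V\<close> and each \<open>W i\<close> are comonads. The index set is arbitrary.\<close>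

locale kleisli_law_comonads =
  kleisli_law I \<C> W D V H \<kappa> + V: comonad D V + H: is_functor "prod_cat I \<C>" D H
  for I :: "'i set" and \<C> :: "'i \<Rightarrow> ('o, 'a) cat" and W :: "'i \<Rightarrow> ('o, 'a) comonad_data"
    and D :: "('p, 'b) cat" and V :: "('p, 'b) comonad_data"
    and H :: "('i \<Rightarrow> 'o, 'i \<Rightarrow> 'a, 'p, 'b) ftr" and \<kappa> :: "('i \<Rightarrow> 'o) \<Rightarrow> 'b" +
  assumes comonads: "i \<in> I \<Longrightarrow> comonad (\<C> i) (W i)"
begin

section \<open>Categories, functors and counits of the product situation\<close>

abbreviation "P \<equiv> prod_cat I \<C>"
abbreviation "Q \<equiv> prod_cat I (\<lambda>i. EM (\<C> i) (W i))"
abbreviation "E \<equiv> EM D V"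
abbreviation "K \<equiv> prod_ftr I (\<lambda>i. Ftr (W i))"
abbreviation "U \<equiv> prod_ftr I (\<lambda>i. forget :: ('o \<times> 'a, ('o \<times> 'a) \<times> 'a \<times> ('o \<times> 'a), 'o, 'a) ftr)"
abbreviation "J \<equiv> prod_ftr I (\<lambda>i. cofree (\<C> i) (W i))"
abbreviation "R \<equiv> cofree D V"
abbreviation "\<epsilon> A \<equiv> (\<lambda>i\<in>I. counit (W i) (A i))"
abbreviation "\<delta> A \<equiv> (\<lambda>i\<in>I. comult (W i) (A i))"

lemma K_functor: "is_functor P P K"
  by (rule is_functor_prod_ftr) (rule comonad.axioms(2)[OF comonads])

lemma U_functor: "is_functor Q P U"
  by (rule is_functor_prod_ftr) (rule comonad.is_functor_forget[OF comonads])

lemma J_functor: "is_functor P Q J"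
  by (rule is_functor_prod_ftr) (rule comonad.is_functor_cofree[OF comonads])

lemma R_functor: "is_functor D E R"
  by (rule V.is_functor_cofree)

sublocale K: is_functor P P K by (rule K_functor)
sublocale E: category E by (rule V.category_EM)
sublocale R: is_functor D E R by (rule R_functor)

text \<open>The two functors are equal, not just isomorphic: the tuples agree on \<open>I\<close>
  and are \<open>undefined\<close> elsewhere. Composites can therefore be rewritten along this
  equation.\<close>

lemma U_J: "U \<circ>\<^sub>F J = K"
  by (simp add: comp_ftr_def prod_ftr_def fun_eq_iff restrict_def)

lemma K_U: "prod_ftr I (\<lambda>i. Ftr (W i) \<circ>\<^sub>F forget) = K \<circ>\<^sub>F U"
  by (simp add: comp_ftr_def prod_ftr_def fun_eq_iff restrict_def)

lemma \<delta>_Hom: "A \<in> Obj P \<Longrightarrow> \<delta> A \<in> Hom P (FObj K A) (FObj K (FObj K A))"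
  using comonad.comult_Hom[OF comonads]
  by (auto simp: Obj_prod_cat Hom_prod_cat FObj_prod_ftr PiE_iff)

text \<open>A product of identity functors restricts tuples to \<open>I\<close>, so in general it is
  not literally \<open>id_ftr\<close>. Naturality is therefore checked by components rather than
  taken from \<open>nat_trans_prod\<close>.\<close>

lemma \<epsilon>_natural: "nat_trans P P K id_ftr \<epsilon>"
proof -
  have counit: "nat_trans (\<C> i) (\<C> i) (Ftr (W i)) id_ftr (counit (W i))" if "i \<in> I" for i
    using comonads[OF that] by (simp add: comonad_def)
  interpret id: is_functor P P id_ftr
    by unfold_locales (simp_all add: id_ftr_def)
  show ?thesis
  proof
    fix A assume "A \<in> Obj P"
    then show "\<epsilon> A \<in> Hom P (FObj K A) (FObj id_ftr A)"
      using nat_trans.component[OF counit]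
      by (auto simp: Obj_prod_cat Hom_prod_cat FObj_prod_ftr PiE_iff id_ftr_def)
  next
    fix f A B assume "f \<in> Hom P A B"
    then show "\<epsilon> B \<cdot>\<^bsub>P\<^esub> FArr K f = FArr id_ftr f \<cdot>\<^bsub>P\<^esub> \<epsilon> A"
      using nat_trans.naturality[OF counit]
      by (auto simp: Hom_prod_cat FArr_prod_ftr id_ftr_def intro!: extensionalityI[of _ I])
  qed
qed

lemma \<epsilon>_Hom: "A \<in> Obj P \<Longrightarrow> \<epsilon> A \<in> Hom P (FObj K A) A"
  using nat_trans.component[OF \<epsilon>_natural] by (simp add: id_ftr_def)

lemma K\<epsilon>_\<delta>: "A \<in> Obj P \<Longrightarrow> FArr K (\<epsilon> A) \<cdot>\<^bsub>P\<^esub> \<delta> A = Idn P (FObj K A)"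
  using comonad.counit_right[OF comonads]
  by (auto simp: Obj_prod_cat FObj_prod_ftr FArr_prod_ftr PiE_iff intro!: extensionalityI[of _ I])

lemma \<kappa>_Hom: "A \<in> Obj P \<Longrightarrow> \<kappa> A \<in> Hom D (FObj (Ftr V) (FObj H A)) (FObj H (FObj K A))"
  using component by simp

text \<open>The tuple of second components consists of the structure maps of the coalgebras, so this
  is the first arrow of the pair, the cofree image of H \<alpha>.\<close>

definition "\<phi> X = FArr (R \<circ>\<^sub>F H) (\<lambda>i\<in>I. snd (X i))"

text \<open>The second arrow of the pair: the law \<kappa> at the underlying objects, made into a
  coalgebra morphism by extension. It does not depend on the structure maps.\<close>

definition "\<psi> X = coextend D V (FObj (H \<circ>\<^sub>F U) X) (FObj ((H \<circ>\<^sub>F K) \<circ>\<^sub>F U) X) (\<kappa> (FObj U X))"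

text \<open>Structure maps are natural in each component, hence as a tuple, and whiskering with the
  functor \<open>R\<close> after \<open>H\<close> preserves this.\<close>

lemma \<phi>_natural: "nat_trans Q E (R \<circ>\<^sub>F H \<circ>\<^sub>F U) (R \<circ>\<^sub>F (H \<circ>\<^sub>F K) \<circ>\<^sub>F U) \<phi>"
proof -
  have "nat_trans Q P U (K \<circ>\<^sub>F U) (\<lambda>X. \<lambda>i\<in>I. snd (X i))"
    unfolding K_U[symmetric]
    by (rule nat_trans_prod) (rule comonad.nat_trans_coalgebra[OF comonads])
  then show ?thesis
    using nat_trans_whisker_left[OF _ is_functor_comp_ftr[OF H.is_functor_axioms R_functor]]
    unfolding \<phi>_def comp_ftr_assoc by blast
qed

lemma \<psi>_natural: "nat_trans Q E (R \<circ>\<^sub>F H \<circ>\<^sub>F U) (R \<circ>\<^sub>F (H \<circ>\<^sub>F K) \<circ>\<^sub>F U) \<psi>"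
  unfolding \<psi>_def
proof (rule V.coextend_natural)
  show "is_functor Q D (H \<circ>\<^sub>F U)"
    by (rule is_functor_comp_ftr[OF U_functor H.is_functor_axioms])
  show "nat_trans Q D (Ftr V \<circ>\<^sub>F H \<circ>\<^sub>F U) ((H \<circ>\<^sub>F K) \<circ>\<^sub>F U) (\<lambda>X. \<kappa> (FObj U X))"
    using nat_trans_whisker_right[OF U_functor nat_trans_axioms] by (simp add: comp_ftr_assoc)
qed

text \<open>\<open>split_equaliser_iso\<close> applies with \<open>?e\<close>, \<open>?s\<close> and
  \<open>?t\<close>. The isomorphism is stated in the direction out of the equaliser, where it is a
  composite of arrows already known to be natural in \<open>X\<close>.\<close>

lemma cofree_pair_split:
  assumes X: "X \<in> Obj P" and eq: "is_equaliser E (\<phi> (FObj J X)) (\<psi> (FObj J X)) q"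
  shows "iso_arr E (FArr (R \<circ>\<^sub>F H) (\<epsilon> X) \<cdot>\<^bsub>E\<^esub> q)"
proof -
  let ?e = "coextend D V (FObj H X) (FObj H (FObj K X)) (\<kappa> X)"
  let ?s = "FArr R (FArr H (\<epsilon> X))" and ?t = "FArr R (FArr H (FArr K (\<epsilon> X)))"
  have KX: "FObj K X \<in> Obj P" using K.FObj_Obj[OF X] .
  have HX: "FObj H X \<in> Obj D" and HKX: "FObj H (FObj K X) \<in> Obj D"
    using H.FObj_Obj X KX by auto
  note H\<delta> = H.FArr_Hom[OF \<delta>_Hom[OF X]] and H\<epsilon> = H.FArr_Hom[OF \<epsilon>_Hom[OF X]]
    and HK\<epsilon> = H.FArr_Hom[OF K.FArr_Hom[OF \<epsilon>_Hom[OF X]]]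
  note \<kappa>X = \<kappa>_Hom[OF X] and \<kappa>KX = \<kappa>_Hom[OF KX]
  have UJ: "FObj U (FObj J X) = FObj K X"
    using U_J by (metis FObj_comp_ftr)
  have "(\<lambda>i\<in>I. snd (FObj J X i)) = \<delta> X"
    by (simp add: FObj_prod_ftr fun_eq_iff restrict_def)
  then have \<phi>: "\<phi> (FObj J X) = FArr R (FArr H (\<delta> X))"
    by (simp add: \<phi>_def)
  have \<psi>: "\<psi> (FObj J X)
      = coextend D V (FObj H (FObj K X)) (FObj H (FObj K (FObj K X))) (\<kappa> (FObj K X))"
    by (simp add: \<psi>_def UJ)
  have "iso_arr E (?s \<cdot>\<^bsub>E\<^esub> q)"
  proof (rule E.split_equaliser_iso[OF eq])
    show "\<phi> (FObj J X) \<in> Hom E (FObj R (FObj H (FObj K X))) (FObj R (FObj H (FObj K (FObj K X))))"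
      using R.FArr_Hom[OF H\<delta>] by (simp add: \<phi>)
    show "\<psi> (FObj J X) \<in> Hom E (FObj R (FObj H (FObj K X))) (FObj R (FObj H (FObj K (FObj K X))))"
      using V.coextend_Hom[OF HKX \<kappa>KX] by (simp add: \<psi>)
    show "?e \<in> Hom E (FObj R (FObj H X)) (FObj R (FObj H (FObj K X)))"
      using V.coextend_Hom[OF HX \<kappa>X] .
    show "?s \<in> Hom E (FObj R (FObj H (FObj K X))) (FObj R (FObj H X))"
      using R.FArr_Hom[OF H\<epsilon>] .
    show "?t \<in> Hom E (FObj R (FObj H (FObj K (FObj K X)))) (FObj R (FObj H (FObj K X)))"
      using R.FArr_Hom[OF HK\<epsilon>] .
    \<comment> \<open>Both sides are extensions of arrows out of
      \<open>FObj (Ftr V) (FObj H X)\<close>, and the equality of these arrows is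
      \<open>comult_law\<close>.\<close>
    show "\<phi> (FObj J X) \<cdot>\<^bsub>E\<^esub> ?e = \<psi> (FObj J X) \<cdot>\<^bsub>E\<^esub> ?e"
      unfolding \<phi> \<psi> V.cofree_coextend[OF HX \<kappa>X H\<delta>] V.coextend_coextend[OF HX \<kappa>X \<kappa>KX]
      using comult_law[OF X] by (simp add: FObj_prod_ftr)
    \<comment> \<open>The left side extends \<open>counit V (FObj H X)\<close> by
      \<open>counit_law\<close>, and the extension of a counit is an identity.\<close>
    show "?s \<cdot>\<^bsub>E\<^esub> ?e = Idn E (FObj R (FObj H X))"
      unfolding V.cofree_coextend[OF HX \<kappa>X H\<epsilon>] counit_law[OF X] V.coextend_counit[OF HX] ..
    \<comment> \<open>At cofree coalgebras the structure maps are comultiplications, so this is the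
      image under \<open>H\<close> and \<open>R\<close> of the counit law
      \<open>K\<epsilon>_\<delta>\<close>.\<close>
    show "?t \<cdot>\<^bsub>E\<^esub> \<phi> (FObj J X) = Idn E (FObj R (FObj H (FObj K X)))"
      unfolding \<phi> R.FArr_Cmp[OF H\<delta> HK\<epsilon>, symmetric]
        H.FArr_Cmp[OF \<delta>_Hom[OF X] K.FArr_Hom[OF \<epsilon>_Hom[OF X]], symmetric] K\<epsilon>_\<delta>[OF X]
        H.FArr_Idn[OF KX] R.FArr_Idn[OF HKX] ..
    \<comment> \<open>Both sides are extensions; the arrows extended form the naturality square of
      \<kappa> at the counits, seen as an arrow from \<open>FObj K X\<close> to
      \<open>X\<close>.\<close>
    show "?t \<cdot>\<^bsub>E\<^esub> \<psi> (FObj J X) = ?e \<cdot>\<^bsub>E\<^esub> ?s"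
      unfolding \<psi> V.cofree_coextend[OF HKX \<kappa>KX HK\<epsilon>] V.coextend_cofree[OF H\<epsilon> \<kappa>X]
      using naturality[OF \<epsilon>_Hom[OF X]] by simp
  qed
  then show ?thesis by simp
qed

theorem lifting:
  assumes "has_equalisers E"
  shows "\<exists>H'. is_functor Q E H' \<and> nat_isomorphic P E (H' \<circ>\<^sub>F J) (R \<circ>\<^sub>F H)"
proof -
  obtain L q where L: "is_functor Q E L" and q: "nat_trans Q E L (R \<circ>\<^sub>F H \<circ>\<^sub>F U) q"
    and eq: "\<And>A. A \<in> Obj Q \<Longrightarrow> is_equaliser E (\<phi> A) (\<psi> A) (q A)"
    using equaliser_functor[OF \<phi>_natural \<psi>_natural assms] by blast
  interpret J: is_functor P Q J by (rule J_functor)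
  \<comment> \<open>Restricting \<open>q\<close> along \<open>J\<close> gives a transformation into
    \<open>R \<circ>\<^sub>F H \<circ>\<^sub>F U \<circ>\<^sub>F J\<close>, and \<open>U_J\<close>
    turns the last two factors into \<open>K\<close>. The counits then lead from \<open>K\<close> to
    the identity.\<close>
  have "nat_trans P E (L \<circ>\<^sub>F J) (R \<circ>\<^sub>F H \<circ>\<^sub>F K) (\<lambda>X. q (FObj J X))"
    using nat_trans_whisker_right[OF J_functor q] by (simp add: comp_ftr_assoc U_J)
  moreover have "nat_trans P E (R \<circ>\<^sub>F H \<circ>\<^sub>F K) (R \<circ>\<^sub>F H) (\<lambda>X. FArr (R \<circ>\<^sub>F H) (\<epsilon> X))"
    using nat_trans_whisker_left[OF \<epsilon>_natural is_functor_comp_ftr[OF H.is_functor_axioms R_functor]]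
    by (simp add: comp_ftr_assoc comp_ftr_id_ftr)
  ultimately have "nat_trans P E (L \<circ>\<^sub>F J) (R \<circ>\<^sub>F H)
      (\<lambda>X. FArr (R \<circ>\<^sub>F H) (\<epsilon> X) \<cdot>\<^bsub>E\<^esub> q (FObj J X))"
    by (rule nat_trans_vcomp)
  then have "nat_isomorphic P E (L \<circ>\<^sub>F J) (R \<circ>\<^sub>F H)"
    unfolding nat_isomorphic_def using cofree_pair_split eq J.FObj_Obj by blast
  then show ?thesis using L by blast
qed

end

section \<open>The lifting for comonads indexed by 1 to n\<close>

theorem theorem5p8:
  fixes n :: nat
    and \<C> :: "nat \<Rightarrow> ('o, 'a) cat" and W :: "nat \<Rightarrow> ('o, 'a) comonad_data"
    and D :: "('p, 'b) cat" and V :: "('p, 'b) comonad_data"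
    and H :: "(nat \<Rightarrow> 'o, nat \<Rightarrow> 'a, 'p, 'b) ftr" and \<kappa> :: "(nat \<Rightarrow> 'o) \<Rightarrow> 'b"
  assumes "\<And>i. i \<in> {1..n} \<Longrightarrow> comonad (\<C> i) (W i)"
    and "comonad D V"
    and "is_functor (prod_cat {1..n} \<C>) D H"
    and "kleisli_law {1..n} \<C> W D V H \<kappa>"
    and "has_equalisers (EM D V)"
  shows "\<exists>H'. is_functor (prod_cat {1..n} (\<lambda>i. EM (\<C> i) (W i))) (EM D V) H' \<and>
    nat_isomorphic (prod_cat {1..n} \<C>) (EM D V)
      (H' \<circ>\<^sub>F prod_ftr {1..n} (\<lambda>i. cofree (\<C> i) (W i)))
      (cofree D V \<circ>\<^sub>F H)"
proof -
  have "kleisli_law_comonads {1..n} \<C> W D V H \<kappa>"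
    using assms by (simp add: kleisli_law_comonads_def kleisli_law_comonads_axioms_def)
  then show ?thesis
    using assms(5) by (rule kleisli_law_comonads.lifting)
qed

end
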